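(* Let $(X,d_X)$ and $(Y,d_Y)$ be metric spaces, and let $F:X\to 2^X$ and $G:Y\to 2^Y$ be set-valued maps. If both $F$ and $G$ have the periodic shadowing property, then the product map $F\times G$, defined on $X\times Y$ by $(F\times G)(x,y)=F(x)\times G(y)$, also has the periodic shadowing property with respect to the metric $\hat d((x_1,y_1),(x_2,y_2))=\max\{d_X(x_1,x_2),d_Y(y_1,y_2)\}$.
   Context: Here $\mathbb N=\{0,1,2,\dots\}$ and, for a metric space $Z$, $2^Z$ is the family of nonempty compact subsets of $Z$. For a metric space $(Z,d)$, $x\in Z$ and $A\subset Z$, $d(x,A)=\inf\{d(x,y): y\in A\}$. For a set-valued map $H:Z\to 2^Z$ on a metric space $(Z,d)$: an orbit of $H$ is a sequence $\{x_i\}_{i\in\mathbb N}$ with $x_{i+1}\in H(x_i)$ for all $i$; a $\delta$-pseudo-orbit is a sequence $\{x_i\}_{i\in\mathbb N}$ with $d(x_{i+1},H(x_i))<\delta$ for all $i$; a sequence $\{x_i\}_{i\in\mathbb N}$ is periodic if there is an integer $m\ge 1$ with $x_{i+m}=x_i$ for all $i\in\mathbb N$. $H$ has the periodic shadowing property if for every $\varepsilon>0$ there is $\delta>0$ such that for every periodic $\delta$-pseudo-orbit $\{x_i\}_{i\in\mathbb N}$ of $H$ there is a periodic orbit $\{z_i\}_{i\in\mathbb N}$ of $H$ (not required to have the same period) with $d(z_i,x_i)<\varepsilon$ for all $i\in\mathbb N$. *)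

theory Defs
  imports "HOL-Analysis.Analysis"
begin

text \<open>
  A metric space is a carrier \<open>Z\<close> with a distance function \<open>d\<close> satisfying the library predicate
  \<^const>\<open>Metric_space\<close>. Values outside the carrier are irrelevant, so sequences are
  explicitly required to stay in \<open>Z\<close>.
\<close>

definition nonempty_compacts :: "'a set \<Rightarrow> ('a \<Rightarrow> 'a \<Rightarrow> real) \<Rightarrow> 'a set set" where
  "nonempty_compacts Z d = {A. A \<noteq> {} \<and> compactin (Metric_space.mtopology Z d) A}"

definition set_valued_map :: "'a set \<Rightarrow> ('a \<Rightarrow> 'a \<Rightarrow> real) \<Rightarrow> ('a \<Rightarrow> 'a set) \<Rightarrow> bool" where
  "set_valued_map Z d H \<longleftrightarrow> H \<in> Z \<rightarrow> nonempty_compacts Z d"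

text \<open>\<^const>\<open>infdist\<close> is tied to the type class metric, hence a version for arbitrary \<open>d\<close>.\<close>

definition dist_to_set :: "('a \<Rightarrow> 'a \<Rightarrow> real) \<Rightarrow> 'a \<Rightarrow> 'a set \<Rightarrow> real" where
  "dist_to_set d x A = (INF y\<in>A. d x y)"

definition is_orbit :: "'a set \<Rightarrow> ('a \<Rightarrow> 'a set) \<Rightarrow> (nat \<Rightarrow> 'a) \<Rightarrow> bool" where
  "is_orbit Z H x \<longleftrightarrow> (\<forall>i. x i \<in> Z) \<and> (\<forall>i. x (Suc i) \<in> H (x i))"

definition is_pseudo_orbit ::
  "'a set \<Rightarrow> ('a \<Rightarrow> 'a \<Rightarrow> real) \<Rightarrow> ('a \<Rightarrow> 'a set) \<Rightarrow> real \<Rightarrow> (nat \<Rightarrow> 'a) \<Rightarrow> bool" where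
  "is_pseudo_orbit Z d H \<delta> x \<longleftrightarrow>
     (\<forall>i. x i \<in> Z) \<and> (\<forall>i. dist_to_set d (x (Suc i)) (H (x i)) < \<delta>)"

definition periodic_seq :: "(nat \<Rightarrow> 'a) \<Rightarrow> bool" where
  "periodic_seq x \<longleftrightarrow> (\<exists>m\<ge>1. \<forall>i. x (i + m) = x i)"

definition periodic_shadowing ::
  "'a set \<Rightarrow> ('a \<Rightarrow> 'a \<Rightarrow> real) \<Rightarrow> ('a \<Rightarrow> 'a set) \<Rightarrow> bool" where
  "periodic_shadowing Z d H \<longleftrightarrow>
     (\<forall>\<epsilon>>0. \<exists>\<delta>>0. \<forall>x. is_pseudo_orbit Z d H \<delta> x \<and> periodic_seq x \<longrightarrow>
        (\<exists>z. is_orbit Z H z \<and> periodic_seq z \<and> (\<forall>i. d (z i) (x i) < \<epsilon>)))"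

definition max_dist ::
  "('a \<Rightarrow> 'a \<Rightarrow> real) \<Rightarrow> ('b \<Rightarrow> 'b \<Rightarrow> real) \<Rightarrow> 'a \<times> 'b \<Rightarrow> 'a \<times> 'b \<Rightarrow> real" where
  "max_dist d1 d2 = (\<lambda>(x1, y1) (x2, y2). max (d1 x1 x2) (d2 y1 y2))"

definition product_map :: "('a \<Rightarrow> 'a set) \<Rightarrow> ('b \<Rightarrow> 'b set) \<Rightarrow> 'a \<times> 'b \<Rightarrow> ('a \<times> 'b) set" where
  "product_map F G = (\<lambda>(x, y). F x \<times> G y)"

text \<open>
  Well-definedness: the maximum distance is a metric on the product inducing the product topology,
  and the product of two set-valued maps is a set-valued map for it.
\<close>

lemma Metric_space_max_dist:
  assumes "Metric_space X dX" "Metric_space Y dY"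
  shows "Metric_space (X \<times> Y) (max_dist dX dY)"
proof -
  interpret A: Metric_space X dX by fact
  interpret B: Metric_space Y dY by fact
  show ?thesis
  proof
    fix p q :: "'a \<times> 'b"
    show "0 \<le> max_dist dX dY p q"
      by (auto simp: max_dist_def split: prod.splits intro: max.coboundedI1)
    show "max_dist dX dY p q = max_dist dX dY q p"
      by (auto simp: max_dist_def A.commute B.commute split: prod.splits)
  next
    fix p q assume pq: "p \<in> X \<times> Y" "q \<in> X \<times> Y"
    then obtain a b a' b' where [simp]: "p = (a, b)" "q = (a', b')"
      and mem: "a \<in> X" "b \<in> Y" "a' \<in> X" "b' \<in> Y" by blast
    have "max (dX a a') (dY b b') = 0 \<longleftrightarrow> dX a a' = 0 \<and> dY b b' = 0"
      using A.nonneg[of a a'] B.nonneg[of b b'] by linarith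
    then show "max_dist dX dY p q = 0 \<longleftrightarrow> p = q"
      using mem by (simp add: max_dist_def)
  next
    fix p q r assume "p \<in> X \<times> Y" "q \<in> X \<times> Y" "r \<in> X \<times> Y"
    then show "max_dist dX dY p r \<le> max_dist dX dY p q + max_dist dX dY q r"
      using A.triangle B.triangle by (fastforce simp: max_dist_def)
  qed
qed

lemma mtopology_max_dist:
  assumes "Metric_space X dX" "Metric_space Y dY"
  shows "Metric_space.mtopology (X \<times> Y) (max_dist dX dY) =
    prod_topology (Metric_space.mtopology X dX) (Metric_space.mtopology Y dY)"
proof -
  interpret A: Metric_space X dX by fact
  interpret B: Metric_space Y dY by fact
  interpret P: Metric_space "X \<times> Y" "max_dist dX dY"
    by (rule Metric_space_max_dist) fact+
  have ball: "P.mball (a, b) r = A.mball a r \<times> B.mball b r" for a b r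
    unfolding P.mball_def A.mball_def B.mball_def by (auto simp: max_dist_def)
  show ?thesis
  proof (rule topology_eq[THEN iffD2], intro allI iffI)
    fix S assume S: "openin P.mtopology S"
    show "openin (prod_topology A.mtopology B.mtopology) S"
      unfolding openin_prod_topology_alt
    proof (intro allI impI)
      fix a b assume ab: "(a, b) \<in> S"
      then obtain r where r: "r > 0" "P.mball (a, b) r \<subseteq> S" and "(a, b) \<in> X \<times> Y"
        using S P.openin_mtopology by blast
      then show "\<exists>U V. openin A.mtopology U \<and> openin B.mtopology V \<and> a \<in> U \<and> b \<in> V \<and> U \<times> V \<subseteq> S"
        using ball[of a b r] by (intro exI[of _ "A.mball a r"] exI[of _ "B.mball b r"]) auto
    qed
  next
    fix S assume S: "openin (prod_topology A.mtopology B.mtopology) S"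
    show "openin P.mtopology S"
      unfolding P.openin_mtopology
    proof (intro conjI allI impI)
      show "S \<subseteq> X \<times> Y" using openin_subset[OF S] by simp
      fix p assume p: "p \<in> S"
      obtain a b where [simp]: "p = (a, b)" by (cases p)
      obtain U V where UV: "openin A.mtopology U" "openin B.mtopology V" "a \<in> U" "b \<in> V" "U \<times> V \<subseteq> S"
        using S[unfolded openin_prod_topology_alt, rule_format, of a b] p by auto
      obtain r where r: "r > 0" "A.mball a r \<subseteq> U" using UV A.openin_mtopology by blast
      obtain s where s: "s > 0" "B.mball b s \<subseteq> V" using UV B.openin_mtopology by blast
      have "P.mball p (min r s) \<subseteq> S"
      proof -
        have "A.mball a (min r s) \<subseteq> U" "B.mball b (min r s) \<subseteq> V"
          using r(2) s(2) by (auto simp: A.mball_def B.mball_def)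
        then show ?thesis
          unfolding \<open>p = (a, b)\<close> ball using UV(5) by blast
      qed
      then show "\<exists>r>0. P.mball p r \<subseteq> S"
        using r(1) s(1) by (metis min_less_iff_conj)
    qed
  qed
qed

lemma set_valued_map_product_map:
  assumes "Metric_space X dX" "Metric_space Y dY"
    and "set_valued_map X dX F" "set_valued_map Y dY G"
  shows "set_valued_map (X \<times> Y) (max_dist dX dY) (product_map F G)"
proof -
  have "product_map F G p \<in> nonempty_compacts (X \<times> Y) (max_dist dX dY)" if mem: "p \<in> X \<times> Y" for p
  proof -
    obtain x y where p: "p = (x, y)" "x \<in> X" "y \<in> Y" using mem by blast
    have "F x \<in> nonempty_compacts X dX" "G y \<in> nonempty_compacts Y dY"
      using assms(3,4) p(2,3) unfolding set_valued_map_def by (auto dest: PiE)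
    then show ?thesis
      unfolding nonempty_compacts_def mtopology_max_dist[OF assms(1,2)]
      by (simp add: p(1) product_map_def compactin_Times)
  qed
  then show ?thesis unfolding set_valued_map_def by (rule Pi_I)
qed

end

theory Submission
  imports Defs
begin

text \<open>The distance in either factor never exceeds the maximum distance, so the coordinates of a
  \<open>\<delta>\<close>-pseudo-orbit of the product are \<open>\<delta>\<close>-pseudo-orbits; shadow them separately and pair the
  shadowing orbits, which is again periodic because any two periods have a common multiple.\<close>

text \<open>Each pair \<open>(x, y)\<close> in \<open>A \<times> B\<close> is matched with
  \<open>x\<close> in \<open>A\<close>, and \<open>dX a x\<close> is at most the maximum distance
  from \<open>(a, b)\<close> to the pair. Both sets are nonempty so that the infimum over
  \<open>A \<times> B\<close> is a genuine one.\<close>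

lemma dist_to_set_le_max_dist_fst:
  assumes "Metric_space X dX" "A \<noteq> {}" "B \<noteq> {}"
  shows "dist_to_set dX a A \<le> dist_to_set (max_dist dX dY) (a, b) (A \<times> B)"
  unfolding dist_to_set_def
proof (rule cINF_mono)
  \<comment> \<open>Real infima are conditionally complete: the smaller infimum needs a lower bound,
    here 0.\<close>
  show "bdd_below (dX a ` A)"
    by (rule bdd_belowI2[of _ 0]) (rule Metric_space.nonneg[OF assms(1)])
qed (use assms in \<open>force simp: max_dist_def intro: max.cobounded1\<close>)+

lemma dist_to_set_le_max_dist_snd:
  assumes "Metric_space Y dY" "A \<noteq> {}" "B \<noteq> {}"
  shows "dist_to_set dY b B \<le> dist_to_set (max_dist dX dY) (a, b) (A \<times> B)"
  unfolding dist_to_set_def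
proof (rule cINF_mono)
  show "bdd_below (dY b ` B)"
    by (rule bdd_belowI2[of _ 0]) (rule Metric_space.nonneg[OF assms(1)])
qed (use assms in \<open>force simp: max_dist_def intro: max.cobounded2\<close>)+

lemma set_valued_map_nonempty:
  assumes "set_valued_map Z d H" "z \<in> Z"
  shows "H z \<noteq> {}"
  using assms by (auto simp: set_valued_map_def nonempty_compacts_def Pi_iff)

text \<open>Lets one tolerance serve both factors, each of which comes with its own
  \<delta>.\<close>

lemma is_pseudo_orbit_mono:
  assumes "is_pseudo_orbit Z d H \<delta> x" "\<delta> \<le> \<delta>'"
  shows "is_pseudo_orbit Z d H \<delta>' x"
  using assms unfolding is_pseudo_orbit_def by (meson order_less_le_trans)

lemma is_pseudo_orbit_product_mapD:
  assumes "Metric_space X dX" "Metric_space Y dY"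
    and F: "set_valued_map X dX F" and G: "set_valued_map Y dY G"
    and p: "is_pseudo_orbit (X \<times> Y) (max_dist dX dY) (product_map F G) \<delta> p"
  shows "is_pseudo_orbit X dX F \<delta> (fst \<circ> p)" "is_pseudo_orbit Y dY G \<delta> (snd \<circ> p)"
proof -
  have mem: "fst (p i) \<in> X" "snd (p i) \<in> Y" for i
    using p by (auto simp: is_pseudo_orbit_def mem_Times_iff)
  \<comment> \<open>Nonempty values are what allows the infima over a factor and over the product to
    be compared.\<close>
  have ne: "F (fst (p i)) \<noteq> {}" "G (snd (p i)) \<noteq> {}" for i
    using set_valued_map_nonempty F G mem by metis+
  have less: "dist_to_set (max_dist dX dY) (fst (p (Suc i)), snd (p (Suc i)))
      (F (fst (p i)) \<times> G (snd (p i))) < \<delta>" for i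
    using p by (simp add: is_pseudo_orbit_def product_map_def case_prod_unfold)
  show "is_pseudo_orbit X dX F \<delta> (fst \<circ> p)"
    using order_le_less_trans[OF dist_to_set_le_max_dist_fst[OF assms(1) ne] less] mem
    by (simp add: is_pseudo_orbit_def)
  show "is_pseudo_orbit Y dY G \<delta> (snd \<circ> p)"
    using order_le_less_trans[OF dist_to_set_le_max_dist_snd[OF assms(2) ne] less] mem
    by (simp add: is_pseudo_orbit_def)
qed

lemma is_orbit_product_mapI:
  assumes "is_orbit X F u" "is_orbit Y G v"
  shows "is_orbit (X \<times> Y) (product_map F G) (\<lambda>i. (u i, v i))"
  using assms by (simp add: is_orbit_def product_map_def)

text \<open>Applied to \<open>fst\<close> and \<open>snd\<close>: a period of the pseudo-orbit is a
  period of each coordinate.\<close>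

lemma periodic_seq_comp:
  assumes "periodic_seq x"
  shows "periodic_seq (f \<circ> x)"
  using assms by (auto simp: periodic_seq_def)

lemma add_mult_period:
  fixes x :: "nat \<Rightarrow> 'a"
  assumes "\<And>i. x (i + m) = x i"
  shows "x (i + k * m) = x i"
proof (induction k)
  case (Suc k)
  then show ?case using assms[of "i + k * m"] by (simp add: ac_simps)
qed simp

text \<open>The two shadowing orbits may have different periods \<open>m\<close> and
  \<open>n\<close>; their product is a common one.\<close>

lemma periodic_seq_Pair:
  assumes "periodic_seq u" "periodic_seq v"
  shows "periodic_seq (\<lambda>i. (u i, v i))"
proof -
  obtain m n where "m \<ge> 1" "n \<ge> 1" and u: "\<And>i. u (i + m) = u i" and v: "\<And>i. v (i + n) = v i"
    using assms by (auto simp: periodic_seq_def)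
  \<comment> \<open>A shift by \<open>n * m\<close> is \<open>n\<close> periods of \<open>u\<close>
    and also \<open>m\<close> periods of \<open>v\<close>.\<close>
  have "u (i + n * m) = u i" "v (i + n * m) = v i" for i
    using add_mult_period[of u m i n, OF u] add_mult_period[of v n i m, OF v]
    by (simp_all add: mult.commute)
  moreover have "n * m \<ge> 1" using \<open>m \<ge> 1\<close> \<open>n \<ge> 1\<close> by simp
  ultimately show ?thesis unfolding periodic_seq_def by blast
qed

theorem proposition5p6:
  fixes X :: "'a set" and dX :: "'a \<Rightarrow> 'a \<Rightarrow> real" and F :: "'a \<Rightarrow> 'a set"
    and Y :: "'b set" and dY :: "'b \<Rightarrow> 'b \<Rightarrow> real" and G :: "'b \<Rightarrow> 'b set"
  assumes "Metric_space X dX" and "Metric_space Y dY"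
    and "set_valued_map X dX F" and "set_valued_map Y dY G"
    and "periodic_shadowing X dX F" and "periodic_shadowing Y dY G"
  shows "periodic_shadowing (X \<times> Y) (max_dist dX dY) (product_map F G)"
  unfolding periodic_shadowing_def
proof (intro allI impI)
  fix \<epsilon> :: real assume "\<epsilon> > 0"
  obtain \<delta>1 where "\<delta>1 > 0"
    and F: "\<And>x. is_pseudo_orbit X dX F \<delta>1 x \<Longrightarrow> periodic_seq x \<Longrightarrow>
      \<exists>z. is_orbit X F z \<and> periodic_seq z \<and> (\<forall>i. dX (z i) (x i) < \<epsilon>)"
    using assms(5) \<open>\<epsilon> > 0\<close> unfolding periodic_shadowing_def by meson
  obtain \<delta>2 where "\<delta>2 > 0"
    and G: "\<And>y. is_pseudo_orbit Y dY G \<delta>2 y \<Longrightarrow> periodic_seq y \<Longrightarrow>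
      \<exists>z. is_orbit Y G z \<and> periodic_seq z \<and> (\<forall>i. dY (z i) (y i) < \<epsilon>)"
    using assms(6) \<open>\<epsilon> > 0\<close> unfolding periodic_shadowing_def by meson
  \<comment> \<open>The minimum makes each coordinate fine enough for the shadowing property of its
    own factor.\<close>
  let ?\<delta> = "min \<delta>1 \<delta>2"
  have "\<exists>z. is_orbit (X \<times> Y) (product_map F G) z \<and> periodic_seq z \<and>
      (\<forall>i. max_dist dX dY (z i) (p i) < \<epsilon>)"
    if p: "is_pseudo_orbit (X \<times> Y) (max_dist dX dY) (product_map F G) ?\<delta> p" "periodic_seq p" for p
  proof -
    note po = is_pseudo_orbit_product_mapD[OF assms(1-4) p(1)]
    obtain u where u: "is_orbit X F u" "periodic_seq u" "\<And>i. dX (u i) (fst (p i)) < \<epsilon>"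
      using F[OF is_pseudo_orbit_mono[OF po(1)] periodic_seq_comp[OF p(2)]] by auto
    obtain v where v: "is_orbit Y G v" "periodic_seq v" "\<And>i. dY (v i) (snd (p i)) < \<epsilon>"
      using G[OF is_pseudo_orbit_mono[OF po(2)] periodic_seq_comp[OF p(2)]] by auto
    \<comment> \<open>A maximum lies below \<epsilon> once both entries do, so each factor is
      shadowed with the full \<epsilon>.\<close>
    have "max_dist dX dY (u i, v i) (p i) < \<epsilon>" for i
      using u(3) v(3) by (simp add: max_dist_def case_prod_unfold)
    then show ?thesis
      using is_orbit_product_mapI[OF u(1) v(1)] periodic_seq_Pair[OF u(2) v(2)] by blast
  qed
  then show "\<exists>\<delta>>0. \<forall>p. is_pseudo_orbit (X \<times> Y) (max_dist dX dY) (product_map F G) \<delta> p \<and>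
      periodic_seq p \<longrightarrow> (\<exists>z. is_orbit (X \<times> Y) (product_map F G) z \<and> periodic_seq z \<and>
        (\<forall>i. max_dist dX dY (z i) (p i) < \<epsilon>))"
    using \<open>\<delta>1 > 0\<close> \<open>\<delta>2 > 0\<close> by (intro exI[of _ ?\<delta>]) simp
qed

end
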